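(* Let $m\ge2$, let $C_1,\dots,C_m$ be closed subsets of a Euclidean space $X$, $I=\{1,\dots,m\}$, $w\in C:=\bigcap_{i\in I}C_i$, $\varepsilon\in[0,1)$, $\delta>0$, and $\tau_i\ge0$ for every $i\in I$. Suppose that: (a) $\{C_i\}_{i\in I}$ is $\kappa$-linearly regular on $\mathbb{B}(w;\delta/2)$ for some $\kappa>0$. (b) $\{C_i\}_{i\in I}$ is $(\varepsilon,\delta)$-regular at $w$. (c) For every $i\in I$, $\lambda_i\in[1,2)$ and $C_i$ is $\tau_i$-injectable on $\mathbb{B}(w;\delta/2)$, with $\tau_i>0$ whenever $\lambda_i>1$. (d) Setting $\Gamma:=\max_{j\in I}\prod_{i\in I\setminus\{j\}}\big(1+\frac{\lambda_i\varepsilon}{1-\varepsilon}\big)^{1/2}$, it holds that $$\rho:=\left[\Gamma^2-\frac{1}{\kappa^2}\Big(\Big(\sum_{i\in I}\frac{\lambda_i}{2-\lambda_i}\Big)-\min_{i\in I}\frac{\lambda_i}{2-\lambda_i}\Big)^{-1}\right]_+^{\frac{1}{2(m-1)}}<1 .$$ Then, whenever the starting point $x_0$ is sufficiently close to $w$ (i.e., there is $r>0$ such that this holds for all $x_0\in\mathbb{B}(w;r)$), every cyclic sequence $(x_n)_{n\in\mathbb{N}}$ generated by the relaxed projections $(P_{C_i}^{\lambda_i})_{i\in I}$ converges $R$-linearly to a point $\bar x\in C$ with rate $\rho$. In particular, after shrinking $\delta$ if necessary so that $\delta/2\le\min\{\tau_i:\lambda_i>1\}$ (no condition if all $\lambda_i=1$),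 this linear convergence is guaranteed provided that either $(x_{(m-1)n})_{n\in\mathbb{N}}\subset\mathbb{B}(w;\overline\delta)$ or $x_0\in\mathbb{B}\big(w;\frac{\overline\delta(1-\rho)}{2+\Gamma-\rho}\big)$, where $\overline\delta:=\frac{\delta}{2\Gamma}\big(1+\max_{i\in I}\frac{\lambda_i\varepsilon}{1-\varepsilon}\big)^{-1/2}$.
   Context: $X$ is a Euclidean space with inner product $\langle\cdot,\cdot\rangle$ and norm $\|\cdot\|$. $\mathbb{B}(w;\rho)$ is the closed ball with center $w$ and radius $\rho$. $[t]_+:=\max\{0,t\}$. For a nonempty closed set $C$: $d_C(x)=\inf_{c\in C}\|x-c\|$, $P_Cx=\{c\in C:\|x-c\|=d_C(x)\}$ (set-valued projector), and the relaxed projector with parameter $\lambda\ge0$ is $P_C^\lambda:=(1-\lambda)\mathrm{Id}+\lambda P_C$ (set-valued). Cyclic sequences: for set-valued operators $T_1,\dots,T_m$ on $X$, put $T_{mn+i}:=T_i$ for $n\in\mathbb{N}$, $i\in I$; a cyclic sequence generated by $(T_i)_{i\in I}$ is any sequence with $x_0\in X$ and $x_{n+1}\in T_{n+1}x_n$ for all $n\in\mathbb{N}=\{0,1,2,\dots\}$. $R$-linear convergence: $(x_n)$ converges $R$-linearly to $\bar x$ with rate $\rho\in[0,1)$ if there is $\sigma\ge0$ with $\|x_n-\bar x\|\le\sigma\rho^n$ for all $n\in\mathbb{N}$. Linear regularity: $\{C_i\}_{i\in I}$ is $\kappa$-linearly regular on $U\subseteq X$ if $d_C(x)\le\kappa\max_{i\in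 I}d_{C_i}(x)$ for all $x\in U$, where $C=\bigcap_{i\in I}C_i$. Regularity of sets: the proximal normal cone to $C$ at $x\in C$ is $N^{\rm prox}_C(x)=\{\lambda(z-x): x\in P_Cz,\ \lambda\ge0\}$. $C$ is $(\varepsilon,\delta)$-regular at $w$ if for all $x,y\in C\cap\mathbb{B}(w;\delta)$ and $u\in N^{\rm prox}_C(x)$ one has $\langle u,x-y\rangle\ge-\varepsilon\|u\|\,\|x-y\|$. The system $\{C_i\}_{i\in I}$ is $(\varepsilon,\delta)$-regular at $w$ if every $C_i$ is. Injectability: a nonempty closed set $C$ is $\tau$-injectable on $U$ if for all $x\in U$ and $p\in P_Cx$, the segment $\big[p,\,p+\tau\frac{p-x}{\|p-x\|}\big]$ is contained in $C$, with the convention $\frac{p-x}{\|p-x\|}=0$ if $p=x$.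
   Formalization: When the formula gives ρ = 0, R-linear convergence with rate 0 is asserted only for the shifted sequence (x_{n+1}), since the literal claim fails at n = 1 (e.g. C_1 = R, C_2 = {0}, κ = 1, ε = 0, λ_i = 1). *)

theory Defs
  imports "HOL-Analysis.Analysis"
begin

text \<open>The distance function of a nonempty closed set \<open>C\<close> is \<open>\<lambda>x. infdist x C\<close>.\<close>

definition proj :: "'a::metric_space set \<Rightarrow> 'a \<Rightarrow> 'a set" where
  "proj C x = {c \<in> C. dist x c = infdist x C}"

definition relaxed_proj :: "real \<Rightarrow> 'a::real_normed_vector set \<Rightarrow> 'a \<Rightarrow> 'a set" where
  "relaxed_proj l C x = {(1 - l) *\<^sub>R x + l *\<^sub>R p | p. p \<in> proj C x}"

text \<open>Operators are given with indices \<open>1, \<dots>, m\<close>; \<open>cyclic_op m T\<close> is the periodic extension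
  \<open>T\<^bsub>m n + i\<^esub> = T\<^sub>i\<close> to all indices \<open>\<ge> 1\<close> (its value at index \<open>0\<close> is never used).\<close>

definition cyclic_op :: "nat \<Rightarrow> (nat \<Rightarrow> 'b) \<Rightarrow> nat \<Rightarrow> 'b" where
  "cyclic_op m T k = T ((k - 1) mod m + 1)"

lemma cyclic_op_eq:
  assumes "i \<in> {1..m}"
  shows "cyclic_op m T (m * n + i) = T i"
proof -
  have "m * n + i - 1 = m * n + (i - 1)" using assms by auto
  then have "(m * n + i - 1) mod m = i - 1" using assms by (simp only: mod_mult_self4) auto
  then show ?thesis using assms by (simp only: cyclic_op_def) simp
qed

definition cyclic_sequence :: "nat \<Rightarrow> (nat \<Rightarrow> 'a \<Rightarrow> 'a set) \<Rightarrow> (nat \<Rightarrow> 'a) \<Rightarrow> bool" where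
  "cyclic_sequence m T x \<longleftrightarrow> (\<forall>n. x (n + 1) \<in> cyclic_op m T (n + 1) (x n))"

text \<open>For \<open>\<rho> = 0\<close> the bound reads \<open>x n = xbar\<close> for all \<open>n \<ge> 1\<close>, since \<open>0 ^ 0 = 1\<close>.\<close>

definition R_linearly_converges ::
    "(nat \<Rightarrow> 'a::real_normed_vector) \<Rightarrow> 'a \<Rightarrow> real \<Rightarrow> bool" where
  "R_linearly_converges x xbar \<rho> \<longleftrightarrow>
     0 \<le> \<rho> \<and> \<rho> < 1 \<and> (\<exists>\<sigma>\<ge>0. \<forall>n. norm (x n - xbar) \<le> \<sigma> * \<rho> ^ n)"

definition linearly_regular ::
    "'i set \<Rightarrow> ('i \<Rightarrow> 'a::metric_space set) \<Rightarrow> real \<Rightarrow> 'a set \<Rightarrow> bool" where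
  "linearly_regular I C \<kappa> U \<longleftrightarrow>
     (\<forall>x\<in>U. infdist x (\<Inter>i\<in>I. C i) \<le> \<kappa> * Max ((\<lambda>i. infdist x (C i)) ` I))"

definition prox_normal_cone :: "'a::real_normed_vector set \<Rightarrow> 'a \<Rightarrow> 'a set" where
  "prox_normal_cone C x = {l *\<^sub>R (z - x) | l z. l \<ge> 0 \<and> x \<in> proj C z}"

definition eps_delta_regular ::
    "real \<Rightarrow> real \<Rightarrow> 'a::real_inner set \<Rightarrow> 'a \<Rightarrow> bool" where
  "eps_delta_regular \<epsilon> \<delta> C w \<longleftrightarrow>
     (\<forall>x \<in> C \<inter> cball w \<delta>. \<forall>y \<in> C \<inter> cball w \<delta>. \<forall>u \<in> prox_normal_cone C x.
        inner u (x - y) \<ge> - \<epsilon> * norm u * norm (x - y))"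

text \<open>\<open>sgn v = v /\<^sub>R norm v\<close>, with \<open>sgn 0 = 0\<close>.\<close>

definition injectable :: "real \<Rightarrow> 'a::real_normed_vector set \<Rightarrow> 'a set \<Rightarrow> bool" where
  "injectable \<tau> C U \<longleftrightarrow>
     (\<forall>x\<in>U. \<forall>p\<in>proj C x. closed_segment p (p + \<tau> *\<^sub>R sgn (p - x)) \<subseteq> C)"

text \<open>Convention for the rate in the theorem.  A rate \<open>\<rho> > 0\<close> is understood for the whole sequence.
  When the rate formula gives \<open>\<rho> = 0\<close>, the bound can only be asked of the sequence without its
  starting point: for \<open>C\<^sub>1 = UNIV\<close>, \<open>C\<^sub>2 = {0}\<close>, \<open>m = 2\<close>, \<open>\<epsilon> = 0\<close>, \<open>\<kappa> = 1\<close> and unit relaxation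
  parameters one has \<open>\<rho> = 0\<close> and \<open>x\<^sub>1 = x\<^sub>0 \<noteq> 0 = x\<^sub>2 = x\<^sub>3 = \<dots>\<close>, so that
  \<open>norm (x n - 0) \<le> \<sigma> * 0 ^ n\<close> fails at \<open>n = 1\<close>.\<close>

end

(* By (eps,delta)-regularity, a relaxed projection step is Fejer monotone up to the factor
   1 + lam eps / (1 - eps), with a gain of (2 - lam) / lam times the squared step length.
   Injectability puts x_n into the set it was projected onto, so that from any n >= 1 the
   distances to all the other sets are bounded by the lengths of the next m - 1 steps.  Linear
   regularity and the Cauchy-Schwarz inequality convert the accumulated gain into a contraction
   of the distance to the intersection by the factor rho^(m - 1) per m - 1 steps.  The steps are
   therefore dominated by a geometric series, which gives the limit and also keeps the sequence
   in the ball where the hypotheses hold. *)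

theory Submission
  imports Defs
begin

section \<open>Relaxed projections onto a single set\<close>

text \<open>Both squared distances are expanded at the projection \<open>p\<close> of
  \<open>z\<close>. The only term without a sign is \<open>inner (z - p) (p - c)\<close>; regularity
  at \<open>p\<close> bounds it from below, and the error is absorbed into a multiple of the squared
  distance from \<open>z\<close> to \<open>c\<close>.\<close>

lemma relaxed_proj_fejer:
  fixes C :: "'a::real_inner set"
  assumes reg: "eps_delta_regular \<epsilon> \<delta> C w" and \<epsilon>: "0 \<le> \<epsilon>" "\<epsilon> < 1"
    and w: "w \<in> C" and z: "z \<in> cball w (\<delta> / 2)"
    and l: "0 < l" and z': "z' \<in> relaxed_proj l C z"
    and c: "c \<in> C" "c \<in> cball w \<delta>"
  shows "(norm (z' - c))\<^sup>2 \<le> (1 + l * \<epsilon> / (1 - \<epsilon>)) * (norm (z - c))\<^sup>2 - (2 - l) / l * (norm (z' - z))\<^sup>2"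
proof -
  obtain p where p: "p \<in> proj C z" and z'_eq: "z' = (1 - l) *\<^sub>R z + l *\<^sub>R p"
    using z' by (auto simp: relaxed_proj_def)
  \<comment> \<open>Projecting at most doubles the distance to \<open>w\<close>, so iterates in the
    ball of radius \<open>\<delta> / 2\<close> call on regularity in the ball of radius
    \<open>\<delta>\<close>.\<close>
  have "dist z p \<le> dist z w" using p infdist_le[OF w, of z] by (simp add: proj_def)
  moreover have "dist w p \<le> dist w z + dist z p" by (rule dist_triangle)
  ultimately have "dist w p \<le> \<delta>" using z by (simp add: dist_commute)
  then have pC: "p \<in> C \<inter> cball w \<delta>" using p by (simp add: proj_def)
  have "z - p \<in> prox_normal_cone C p"
    unfolding prox_normal_cone_def using p by (intro CollectI exI[of _ 1] exI[of _ z]) simp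
  then have inner_ge: "inner (z - p) (p - c) \<ge> - \<epsilon> * norm (z - p) * norm (p - c)"
    using reg pC c by (auto simp: eps_delta_regular_def)
  define a b where "a = norm (z - p)" and "b = norm (p - c)"
  have norm_add: "(norm (u + v))\<^sup>2 = (norm u)\<^sup>2 + 2 * inner u v + (norm v)\<^sup>2" for u v :: 'a
    by (simp add: power2_norm_eq_inner inner_add_left inner_add_right inner_commute)
  have zc: "(norm (z - c))\<^sup>2 = a\<^sup>2 + 2 * inner (z - p) (p - c) + b\<^sup>2"
    using norm_add[of "z - p" "p - c"] by (simp add: a_def b_def)
  have "z' - c = (1 - l) *\<^sub>R (z - p) + (p - c)" by (simp add: z'_eq algebra_simps)
  then have "(norm (z' - c))\<^sup>2 = (norm ((1 - l) *\<^sub>R (z - p) + (p - c)))\<^sup>2" by (rule arg_cong)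
  also have "\<dots> = (1 - l)\<^sup>2 * a\<^sup>2 + 2 * (1 - l) * inner (z - p) (p - c) + b\<^sup>2"
    unfolding norm_add by (simp add: a_def b_def power_mult_distrib)
  also have "\<dots> = (norm (z - c))\<^sup>2 - l * (2 - l) * a\<^sup>2 - 2 * l * inner (z - p) (p - c)"
    unfolding zc by (simp add: power2_eq_square algebra_simps)
  finally have z'c: "(norm (z' - c))\<^sup>2 = (norm (z - c))\<^sup>2 - l * (2 - l) * a\<^sup>2 - 2 * l * inner (z - p) (p - c)" .
  have "z' - z = l *\<^sub>R (p - z)" by (simp add: z'_eq algebra_simps)
  then have z'z: "(norm (z' - z))\<^sup>2 = l\<^sup>2 * a\<^sup>2"
    using l by (simp add: a_def power_mult_distrib norm_minus_commute)
  \<comment> \<open>Combined with regularity, \<open>2 * a * b\<close> is at most the squared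
    distance divided by \<open>1 - \<epsilon>\<close>; this is the origin of the denominator in the
    growth factor.\<close>
  have "0 \<le> (a - b)\<^sup>2" by simp
  then have "2 * a * b \<le> a\<^sup>2 + b\<^sup>2" by (simp add: power2_eq_square algebra_simps)
  then have "(1 - \<epsilon>) * (2 * a * b) \<le> (norm (z - c))\<^sup>2"
    using inner_ge unfolding zc a_def[symmetric] b_def[symmetric] by (simp add: algebra_simps)
  then have "2 * a * b \<le> (norm (z - c))\<^sup>2 / (1 - \<epsilon>)"
    using \<epsilon> by (simp add: field_simps)
  then have ab: "(l * \<epsilon>) * (2 * a * b) \<le> (l * \<epsilon>) * ((norm (z - c))\<^sup>2 / (1 - \<epsilon>))"
    using l \<epsilon> by (intro mult_left_mono) auto
  have "l * - inner (z - p) (p - c) \<le> l * (\<epsilon> * a * b)"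
    using inner_ge l unfolding a_def b_def by (intro mult_left_mono) auto
  moreover have "(2 - l) / l * (norm (z' - z))\<^sup>2 = l * (2 - l) * a\<^sup>2"
    using l unfolding z'z by (simp add: power2_eq_square)
  ultimately show ?thesis using z'c ab by (simp add: algebra_simps)
qed

text \<open>The relaxed point overshoots \<open>p\<close> by \<open>(l - 1) * norm (p - z)\<close>.
  As \<open>l < 2\<close>, this is at most \<open>dist w z\<close>, hence at most
  \<open>\<tau>\<close>, so the point lies on the segment granted by injectability. For
  \<open>l = 1\<close> there is no overshoot, which is why the bound by \<open>\<tau>\<close> is
  asked only for \<open>l > 1\<close>.\<close>

lemma relaxed_proj_subset:
  fixes C :: "'a::real_normed_vector set"
  assumes inj: "injectable \<tau> C U" and "1 \<le> l" "l < 2" and w: "w \<in> C"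
    and z: "z \<in> U" "l > 1 \<Longrightarrow> dist w z \<le> \<tau>"
  shows "relaxed_proj l C z \<subseteq> C"
proof
  fix z' assume "z' \<in> relaxed_proj l C z"
  then obtain p where p: "p \<in> proj C z" and z'_eq: "z' = (1 - l) *\<^sub>R z + l *\<^sub>R p"
    by (auto simp: relaxed_proj_def)
  show "z' \<in> C"
  proof (cases "l = 1 \<or> p = z")
    case True
    then have "z' = p" by (auto simp: z'_eq algebra_simps)
    then show ?thesis using p by (simp add: proj_def)
  next
    case False
    then have pz: "norm (p - z) > 0" and "l > 1" using assms by auto
    have "norm (p - z) \<le> dist w z"
      using p infdist_le[OF w, of z] by (simp add: proj_def dist_norm norm_minus_commute)
    then have le: "norm (p - z) \<le> \<tau>" using z(2)[OF \<open>l > 1\<close>] by simp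
    then have "\<tau> > 0" using pz by linarith
    \<comment> \<open>The overshoot as a fraction of \<open>\<tau>\<close>, that is, the parameter
      of \<open>z'\<close> on the segment.\<close>
    define u where "u = (l - 1) * norm (p - z) / \<tau>"
    have "(l - 1) * norm (p - z) \<le> 1 * \<tau>"
      using le pz assms by (intro mult_mono) auto
    then have u: "0 \<le> u" "u \<le> 1" "u * \<tau> = (l - 1) * norm (p - z)"
      using \<open>\<tau> > 0\<close> \<open>l > 1\<close> by (auto simp: u_def)
    have "z' = p + (l - 1) *\<^sub>R (p - z)" by (simp add: z'_eq algebra_simps)
    also have "(l - 1) *\<^sub>R (p - z) = (u * \<tau>) *\<^sub>R sgn (p - z)"
      using pz by (simp add: u(3) sgn_div_norm)
    also have "p + \<dots> = (1 - u) *\<^sub>R p + u *\<^sub>R (p + \<tau> *\<^sub>R sgn (p - z))"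
      by (simp add: algebra_simps)
    finally have "z' \<in> closed_segment p (p + \<tau> *\<^sub>R sgn (p - z))"
      using u by (auto simp: closed_segment_def)
    then show ?thesis using inj z(1) p by (auto simp: injectable_def)
  qed
qed

section \<open>Inequalities for sums, R-linear convergence and cyclic indices\<close>

text \<open>Later factors \<open>g j\<close> multiply the losses collected so far, and being at
  least 1 they only enlarge them; so every loss may be kept with coefficient 1.\<close>

lemma perturbed_contraction_chain:
  fixes a b g :: "nat \<Rightarrow> real"
  assumes "\<And>j. j < k \<Longrightarrow> a (Suc j) \<le> g j * a j - b j"
    and "\<And>j. j < k \<Longrightarrow> g j \<ge> 1" and "\<And>j. j < k \<Longrightarrow> b j \<ge> 0"
  shows "a k \<le> (\<Prod>j<k. g j) * a 0 - (\<Sum>j<k. b j)"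
  using assms
proof (induction k)
  case (Suc k)
  then have IH: "a k \<le> (\<Prod>j<k. g j) * a 0 - (\<Sum>j<k. b j)" by auto
  have g: "g k \<ge> 1" using Suc.prems by simp
  have "0 \<le> (\<Sum>j<k. b j)" using Suc.prems by (intro sum_nonneg) auto
  then have "1 * (\<Sum>j<k. b j) \<le> g k * (\<Sum>j<k. b j)" using g by (intro mult_right_mono)
  moreover have "g k * a k \<le> g k * ((\<Prod>j<k. g j) * a 0 - (\<Sum>j<k. b j))"
    using IH g by (intro mult_left_mono) auto
  moreover have "a (Suc k) \<le> g k * a k - b k" using Suc.prems by simp
  ultimately show ?case by (simp add: algebra_simps)
qed simp

text \<open>With \<open>b\<close> the gain coefficients \<open>(2 - lam) / lam\<close> of the steps,
  the sum of inverses becomes the sum of \<open>lam / (2 - lam)\<close> in the rate.\<close>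

lemma weighted_Cauchy_Schwarz_sum:
  fixes b s :: "'i \<Rightarrow> real"
  assumes "\<And>j. j \<in> J \<Longrightarrow> b j > 0"
  shows "(\<Sum>j\<in>J. s j)\<^sup>2 \<le> (\<Sum>j\<in>J. inverse (b j)) * (\<Sum>j\<in>J. b j * (s j)\<^sup>2)"
proof -
  have "(\<Sum>j\<in>J. s j) = (\<Sum>j\<in>J. sqrt (inverse (b j)) * (sqrt (b j) * s j))"
    by (intro sum.cong refl) (use assms in \<open>force simp: real_sqrt_inverse\<close>)
  also have "\<dots>\<^sup>2 \<le> (\<Sum>j\<in>J. (sqrt (inverse (b j)))\<^sup>2) * (\<Sum>j\<in>J. (sqrt (b j) * s j)\<^sup>2)"
    by (rule Cauchy_Schwarz_ineq_sum)
  also have "(\<Sum>j\<in>J. (sqrt (inverse (b j)))\<^sup>2) = (\<Sum>j\<in>J. inverse (b j))"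
    by (intro sum.cong refl) (use assms in \<open>force simp: less_imp_le\<close>)
  also have "(\<Sum>j\<in>J. (sqrt (b j) * s j)\<^sup>2) = (\<Sum>j\<in>J. b j * (s j)\<^sup>2)"
    by (intro sum.cong refl) (use assms in \<open>force simp: power_mult_distrib less_imp_le\<close>)
  finally show ?thesis .
qed

lemma geometric_steps_imp_R_linear:
  fixes y :: "nat \<Rightarrow> 'a::banach"
  assumes \<rho>: "0 \<le> \<rho>" "\<rho> < 1" and K: "0 \<le> K"
    and step: "\<And>n. norm (y (Suc n) - y n) \<le> K * \<rho> ^ n"
  obtains ybar where "y \<longlonglongrightarrow> ybar" "R_linearly_converges y ybar \<rho>"
proof -
  have far: "norm (y (n + j) - y n) \<le> K / (1 - \<rho>) * \<rho> ^ n" for n j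
  proof -
    \<comment> \<open>The induction runs on the partial geometric sum; the bound without the
      subtracted power is not inductive.\<close>
    have "norm (y (n + j) - y n) \<le> K / (1 - \<rho>) * (\<rho> ^ n - \<rho> ^ (n + j))"
    proof (induction j)
      case (Suc j)
      have "norm (y (n + Suc j) - y n) \<le> norm (y (Suc (n + j)) - y (n + j)) + norm (y (n + j) - y n)"
        using norm_triangle_ineq[of "y (Suc (n + j)) - y (n + j)" "y (n + j) - y n"] by simp
      also have "\<dots> \<le> K * \<rho> ^ (n + j) + K / (1 - \<rho>) * (\<rho> ^ n - \<rho> ^ (n + j))"
        using step[of "n + j"] Suc by simp
      also have "\<dots> = K / (1 - \<rho>) * (\<rho> ^ n - \<rho> ^ (n + Suc j))"
        using \<rho> by (simp add: field_simps)
      finally show ?case .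
    qed simp
    also have "\<dots> \<le> K / (1 - \<rho>) * \<rho> ^ n"
      using \<rho> K by (intro mult_left_mono) auto
    finally show ?thesis .
  qed
  have bound0: "(\<lambda>n. K / (1 - \<rho>) * \<rho> ^ n) \<longlonglongrightarrow> 0"
    using \<rho> by (intro tendsto_mult_right_zero LIMSEQ_power_zero) auto
  have "Cauchy y"
  proof (rule metric_CauchyI)
    fix e :: real assume "0 < e"
    then have "\<forall>\<^sub>F n in sequentially. K / (1 - \<rho>) * \<rho> ^ n < e / 2"
      using order_tendstoD(2)[OF bound0, of "e / 2"] by simp
    then obtain M where M: "K / (1 - \<rho>) * \<rho> ^ M < e / 2"
      by (auto simp: eventually_sequentially)
    have near: "dist (y n) (y M) < e / 2" if "n \<ge> M" for n
    proof -
      have "norm (y n - y M) \<le> K / (1 - \<rho>) * \<rho> ^ M" using far[of M "n - M"] that by simp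
      then show ?thesis using M unfolding dist_norm by linarith
    qed
    show "\<exists>M. \<forall>n\<ge>M. \<forall>n'\<ge>M. dist (y n) (y n') < e"
      using near dist_triangle_half_l by blast
  qed
  then obtain ybar where lim: "y \<longlonglongrightarrow> ybar"
    using Cauchy_convergent convergent_def by blast
  have "norm (y n - ybar) \<le> K / (1 - \<rho>) * \<rho> ^ n" for n
  proof -
    have "(\<lambda>j. norm (y (j + n) - y n)) \<longlonglongrightarrow> norm (ybar - y n)"
      using LIMSEQ_ignore_initial_segment[OF lim] by (intro tendsto_intros)
    moreover have "norm (y (j + n) - y n) \<le> K / (1 - \<rho>) * \<rho> ^ n" for j
      using far[of n j] by (simp add: add.commute)
    ultimately have "norm (ybar - y n) \<le> K / (1 - \<rho>) * \<rho> ^ n"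
      by (intro LIMSEQ_le_const2) auto
    then show ?thesis by (simp add: norm_minus_commute)
  qed
  then have "R_linearly_converges y ybar \<rho>"
    using \<rho> K unfolding R_linearly_converges_def by (intro conjI exI[of _ "K / (1 - \<rho>)"]) auto
  with lim show ?thesis by (rule that)
qed

text \<open>Shifting the index costs a factor \<open>1 / \<rho>\<close>, and the starting point is
  paid for by a separate term in the constant. The division is why a zero rate is excluded.\<close>

lemma R_linearly_converges_shift:
  assumes "R_linearly_converges (\<lambda>n. x (n + 1)) xbar \<rho>" and "\<rho> > 0"
  shows "R_linearly_converges x xbar \<rho>"
proof -
  obtain \<sigma> where \<sigma>: "\<sigma> \<ge> 0" "\<And>n. norm (x (n + 1) - xbar) \<le> \<sigma> * \<rho> ^ n"
    using assms by (auto simp: R_linearly_converges_def)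
  define s where "s = max (\<sigma> / \<rho>) (norm (x 0 - xbar))"
  have "norm (x n - xbar) \<le> s * \<rho> ^ n" for n
  proof (cases n)
    case (Suc i)
    have "norm (x n - xbar) \<le> \<sigma> / \<rho> * \<rho> ^ n" using \<sigma>(2)[of i] Suc assms(2) by simp
    also have "\<dots> \<le> s * \<rho> ^ n" using assms(2) by (intro mult_right_mono) (auto simp: s_def)
    finally show ?thesis .
  qed (simp add: s_def)
  moreover have "s \<ge> 0" by (simp add: s_def le_max_iff_disj)
  ultimately show ?thesis using assms(1) by (auto simp: R_linearly_converges_def)
qed

text \<open>A window of \<open>m\<close> consecutive integers meets every residue once, so a window
  of \<open>m - 1\<close> misses only the index that would come next. This is why one index is left
  out of the products in \<open>\<Gamma>\<close> and of the sum in the rate.\<close>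

lemma bij_betw_cyclic_index:
  fixes m N :: nat
  assumes "m \<ge> 1"
  shows "bij_betw (\<lambda>n. n mod m + 1) {N..<N + (m - 1)} ({1..m} - {(N + (m - 1)) mod m + 1})"
proof -
  let ?f = "\<lambda>n::nat. n mod m + 1"
  have inj: "inj_on ?f {N..<N + m}"
  proof (rule linorder_inj_onI)
    fix i j assume ij: "i < j" "i \<in> {N..<N + m}" "j \<in> {N..<N + m}"
    show "?f i \<noteq> ?f j"
    proof
      assume "?f i = ?f j"
      then have "j mod m = i mod m" by simp
      then have "m dvd j - i" using mod_eq_dvd_iff_nat[OF less_imp_le[OF ij(1)], of m] by blast
      then have "m \<le> j - i" by (rule dvd_imp_le) (use ij in simp)
      then show False using ij by auto
    qed
  qed auto
  have "?f ` {N..<N + m} \<subseteq> {1..m}" using assms by (auto simp: Suc_le_eq)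
  then have img: "?f ` {N..<N + m} = {1..m}"
    using card_image[OF inj] by (intro card_subset_eq) auto
  have eq: "{N..<N + (m - 1)} = {N..<N + m} - {N + (m - 1)}" using assms by auto
  have "?f ` ({N..<N + m} - {N + (m - 1)}) = ?f ` {N..<N + m} - ?f ` {N + (m - 1)}"
    by (rule inj_on_image_set_diff[OF inj]) (use assms in auto)
  then have "?f ` {N..<N + (m - 1)} = {1..m} - {(N + (m - 1)) mod m + 1}"
    unfolding eq img by simp
  moreover have "inj_on ?f {N..<N + (m - 1)}" using inj unfolding eq by (rule inj_on_diff)
  ultimately show ?thesis by (simp add: bij_betw_def)
qed

section \<open>Setting, index windows and constants\<close>

text \<open>Injectability enters only through its consequence \<open>reach\<close>. The radius
  \<open>\<delta>\<close> may be instantiated by a smaller one, since neither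
  \<open>\<Gamma>\<close> nor \<open>\<rho>\<close> depends on it.\<close>

locale cyclic_relaxed_projections =
  fixes C :: "nat \<Rightarrow> 'a::euclidean_space set" and w :: 'a and m :: nat
    and \<epsilon> \<delta> \<kappa> \<Gamma> \<rho> :: real and lam :: "nat \<Rightarrow> real" and x :: "nat \<Rightarrow> 'a"
  assumes m: "m \<ge> 2"
    and closed: "\<And>i. i \<in> {1..m} \<Longrightarrow> closed (C i)"
    and w: "w \<in> (\<Inter>i\<in>{1..m}. C i)"
    and \<epsilon>: "0 \<le> \<epsilon>" "\<epsilon> < 1" and \<delta>: "\<delta> > 0" and \<kappa>: "\<kappa> > 0"
    and linreg: "linearly_regular {1..m} C \<kappa> (cball w (\<delta> / 2))"
    and reg: "\<And>i. i \<in> {1..m} \<Longrightarrow> eps_delta_regular \<epsilon> \<delta> (C i) w"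
    and lam: "\<And>i. i \<in> {1..m} \<Longrightarrow> 1 \<le> lam i \<and> lam i < 2"
    and reach: "\<And>i z. i \<in> {1..m} \<Longrightarrow> z \<in> cball w (\<delta> / 2) \<Longrightarrow> relaxed_proj (lam i) (C i) z \<subseteq> C i"
    and \<Gamma>_def: "\<Gamma> = Max ((\<lambda>j. \<Prod>i\<in>{1..m} - {j}. sqrt (1 + lam i * \<epsilon> / (1 - \<epsilon>))) ` {1..m})"
    and \<rho>_def: "\<rho> = (max 0 (\<Gamma>\<^sup>2 - 1 / \<kappa>\<^sup>2 *
                    inverse ((\<Sum>i\<in>{1..m}. lam i / (2 - lam i))
                             - Min ((\<lambda>i. lam i / (2 - lam i)) ` {1..m}))))
                  powr (1 / (2 * (real m - 1)))"
    and \<rho>_less: "\<rho> < 1"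
    and cyclic: "cyclic_sequence m (\<lambda>i. relaxed_proj (lam i) (C i)) x"
begin

definition D :: "'a set" where "D = (\<Inter>i\<in>{1..m}. C i)"

definition g :: "nat \<Rightarrow> real" where "g i = 1 + lam i * \<epsilon> / (1 - \<epsilon>)"

text \<open>The largest possible sum of these terms over \<open>m - 1\<close> distinct indices: the
  smallest one is left out.\<close>

definition S :: real where
  "S = (\<Sum>i\<in>{1..m}. lam i / (2 - lam i)) - Min ((\<lambda>i. lam i / (2 - lam i)) ` {1..m})"

text \<open>Offset by one from the cyclic operators: \<open>idx n\<close> belongs to the step from
  \<open>x n\<close> to \<open>x (Suc n)\<close>.\<close>

definition idx :: "nat \<Rightarrow> nat" where "idx n = n mod m + 1"

lemma idx: "idx n \<in> {1..m}"
  using m by (simp add: idx_def Suc_le_eq)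

text \<open>Together with \<open>bij_idx\<close> this identifies the index missed by the window
  starting at \<open>Suc n\<close>: it is that of the set just projected onto.\<close>

lemma idx_period: "idx (Suc n + (m - 1)) = idx n"
proof -
  have "Suc n + (m - 1) = n + m" using m by simp
  then show ?thesis by (simp add: idx_def)
qed

lemma bij_idx: "bij_betw idx {N..<N + (m - 1)} ({1..m} - {idx (N + (m - 1))})"
  using bij_betw_cyclic_index[of m N] m unfolding idx_def by simp

lemma closed_D: "closed D" and w_D: "w \<in> D"
  using closed w by (auto simp: D_def)

lemma g_ge_1: "i \<in> {1..m} \<Longrightarrow> g i \<ge> 1"
  using lam[of i] \<epsilon> by (simp add: g_def)

lemma x_step: "x (Suc n) \<in> relaxed_proj (lam (idx n)) (C (idx n)) (x n)"
  using cyclic by (simp add: cyclic_sequence_def cyclic_op_def idx_def)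

lemma x_in:
  assumes "x n \<in> cball w (\<delta> / 2)"
  shows "x (Suc n) \<in> C (idx n)"
  using reach[OF idx assms] x_step by blast

lemma fejer_step:
  assumes "x n \<in> cball w (\<delta> / 2)" "c \<in> D" "c \<in> cball w \<delta>"
  shows "(norm (x (Suc n) - c))\<^sup>2 \<le> g (idx n) * (norm (x n - c))\<^sup>2
           - (2 - lam (idx n)) / lam (idx n) * (norm (x (Suc n) - x n))\<^sup>2"
  unfolding g_def
proof (rule relaxed_proj_fejer[OF reg[OF idx] \<epsilon> _ assms(1) _ x_step _ assms(3)])
  show "w \<in> C (idx n)" "c \<in> C (idx n)" using w_D assms(2) idx by (auto simp: D_def)
  show "0 < lam (idx n)" using lam[OF idx[of n]] by simp
qed

text \<open>Missing factors can be filled in because all are at least 1. The square appears since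
  \<open>g\<close> acts on squared distances, while \<open>\<Gamma>\<close> multiplies square
  roots.\<close>

lemma prod_g_le_\<Gamma>:
  assumes "j \<in> {1..m}" "J \<subseteq> {1..m} - {j}"
  shows "prod g J \<le> \<Gamma>\<^sup>2"
proof -
  have "prod g J \<le> prod g ({1..m} - {j})"
  proof (rule prod_mono2)
    show "0 \<le> g b" if "b \<in> J" for b
      using g_ge_1[of b] that assms(2) by force
  qed (use assms(2) g_ge_1 in auto)
  also have "\<dots> = (\<Prod>i\<in>{1..m} - {j}. sqrt (g i))\<^sup>2"
    unfolding prod_power_distrib
    by (intro prod.cong refl) (use g_ge_1 in \<open>force intro: order_trans[OF zero_le_one]\<close>)
  also have "\<dots> \<le> \<Gamma>\<^sup>2"
  proof (rule power_mono)
    show "(\<Prod>i\<in>{1..m} - {j}. sqrt (g i)) \<le> \<Gamma>"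
      unfolding \<Gamma>_def g_def using assms(1) by (intro Max_ge) auto
    show "0 \<le> (\<Prod>i\<in>{1..m} - {j}. sqrt (g i))"
      using g_ge_1 by (intro prod_nonneg) (force intro: order_trans[OF zero_le_one])
  qed
  finally show ?thesis .
qed

lemma \<Gamma>_ge_1: "\<Gamma> \<ge> 1"
proof -
  have "1 \<le> (\<Prod>i\<in>{1..m} - {1}. sqrt (g i))"
    using g_ge_1 by (intro prod_ge_1) auto
  also have "\<dots> \<le> \<Gamma>"
    unfolding \<Gamma>_def g_def using m by (intro Max_ge) auto
  finally show ?thesis .
qed

lemma prod_g_idx_le:
  assumes "j \<le> m - 1"
  shows "(\<Prod>i<j. g (idx (N + i))) \<le> \<Gamma>\<^sup>2"
proof -
  have sub: "{N..<N + j} \<subseteq> {N..<N + (m - 1)}" using assms by auto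
  have "(\<Prod>i<j. g (idx (N + i))) = (\<Prod>i\<in>{N..<N + j}. g (idx i))"
    by (rule prod.reindex_bij_witness[of _ "\<lambda>i. i - N" "\<lambda>i. N + i"]) auto
  also have "\<dots> = prod g (idx ` {N..<N + j})"
    using prod.reindex[OF inj_on_subset[OF bij_betw_imp_inj_on[OF bij_idx] sub], of g] by simp
  also have "\<dots> \<le> \<Gamma>\<^sup>2"
    using image_mono[OF sub, of idx] unfolding bij_betw_imp_surj_on[OF bij_idx]
    by (rule prod_g_le_\<Gamma>[OF idx])
  finally show ?thesis .
qed

lemma sum_inverse_idx_le:
  "(\<Sum>i<m - 1. lam (idx (N + i)) / (2 - lam (idx (N + i)))) \<le> S"
proof -
  let ?h = "\<lambda>i. lam i / (2 - lam i)"
  let ?j = "idx (N + (m - 1))"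
  have "(\<Sum>i<m - 1. ?h (idx (N + i))) = (\<Sum>i\<in>{N..<N + (m - 1)}. ?h (idx i))"
    by (rule sum.reindex_bij_witness[of _ "\<lambda>i. i - N" "\<lambda>i. N + i"]) auto
  also have "\<dots> = sum ?h ({1..m} - {?j})"
    by (rule sum.reindex_bij_betw[OF bij_idx])
  also have "\<dots> = sum ?h {1..m} - ?h ?j"
    using idx by (simp add: sum_diff1)
  also have "\<dots> \<le> S"
    using idx unfolding S_def by (intro diff_left_mono Min_le) auto
  finally show ?thesis .
qed

text \<open>Each term is at least 1 because \<open>lam i\<close> is. Besides positivity, this gives
  \<open>S\<close> at least 2 when \<open>m\<close> is at least 3, which the case of zero rate
  needs.\<close>

lemma S_ge: "S \<ge> real (m - 1)"
proof -
  have "real (m - 1) = (\<Sum>i<m - 1. 1)" by simp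
  also have "\<dots> \<le> (\<Sum>i<m - 1. lam (idx (0 + i)) / (2 - lam (idx (0 + i))))"
  proof (rule sum_mono)
    fix i show "1 \<le> lam (idx (0 + i)) / (2 - lam (idx (0 + i)))"
      using lam[OF idx[of "0 + i"]] by simp
  qed
  also have "\<dots> \<le> S" by (rule sum_inverse_idx_le)
  finally show ?thesis .
qed

lemma S_pos: "S > 0"
  using S_ge m by simp

lemma \<rho>_nonneg: "\<rho> \<ge> 0"
  by (simp add: \<rho>_def)

lemma \<rho>_power: "(\<rho> ^ (m - 1))\<^sup>2 = max 0 (\<Gamma>\<^sup>2 - 1 / (\<kappa>\<^sup>2 * S))"
proof -
  define M where "M = max 0 (\<Gamma>\<^sup>2 - 1 / (\<kappa>\<^sup>2 * S))"
  have \<rho>: "\<rho> = M powr (1 / (2 * real (m - 1)))"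
    unfolding \<rho>_def M_def S_def using m by (simp add: of_nat_diff field_simps)
  have "(\<rho> ^ (m - 1))\<^sup>2 = \<rho> ^ (2 * (m - 1))"
    by (simp add: power_mult[symmetric] mult.commute)
  also have "\<dots> = M"
  proof (cases "M = 0")
    \<comment> \<open>Here \<open>0 powr\<close> anything is 0, and the exponent
      \<open>2 * (m - 1)\<close> is positive, so both sides vanish.\<close>
    case True
    then show ?thesis using m by (simp add: \<rho>)
  next
    case False
    then have "M > 0" by (simp add: M_def)
    then have "\<rho> ^ (2 * (m - 1)) = \<rho> powr real (2 * (m - 1))"
      by (subst powr_realpow) (auto simp: \<rho>)
    then show ?thesis using \<open>M > 0\<close> m by (simp add: \<rho> powr_powr)
  qed
  finally show ?thesis by (simp add: M_def)
qed

section \<open>Growth and contraction over one block of steps\<close>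

text \<open>The gain of each step is discarded. Only the iterates before \<open>x (N + j)\<close>
  are assumed to be in the ball, so the bound can serve to place the next iterate there.\<close>

lemma stay:
  assumes in_ball: "\<And>i. i < j \<Longrightarrow> x (N + i) \<in> cball w (\<delta> / 2)"
    and c: "c \<in> D" "c \<in> cball w \<delta>" and j: "j \<le> m - 1"
  shows "norm (x (N + j) - c) \<le> \<Gamma> * norm (x N - c)"
proof -
  have "(norm (x (N + j) - c))\<^sup>2 \<le> (\<Prod>i<j. g (idx (N + i))) * (norm (x (N + 0) - c))\<^sup>2 - (\<Sum>i<j. 0)"
  proof (rule perturbed_contraction_chain[where a = "\<lambda>i. (norm (x (N + i) - c))\<^sup>2"])
    fix i assume "i < j"
    have "0 \<le> (2 - lam (idx (N + i))) / lam (idx (N + i)) * (norm (x (Suc (N + i)) - x (N + i)))\<^sup>2"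
      using lam[OF idx[of "N + i"]] by simp
    then show "(norm (x (N + Suc i) - c))\<^sup>2 \<le> g (idx (N + i)) * (norm (x (N + i) - c))\<^sup>2 - 0"
      using fejer_step[OF in_ball[OF \<open>i < j\<close>] c] by simp
  qed (use g_ge_1[OF idx] in auto)
  also have "\<dots> \<le> \<Gamma>\<^sup>2 * (norm (x N - c))\<^sup>2"
    using prod_g_idx_le[OF j, of N] by (simp add: mult_right_mono)
  finally have "(norm (x (N + j) - c))\<^sup>2 \<le> (\<Gamma> * norm (x N - c))\<^sup>2"
    by (simp add: power_mult_distrib)
  then show ?thesis by (rule power2_le_imp_le) (use \<Gamma>_ge_1 in simp)
qed

lemma nearest_in_D:
  assumes "z \<in> cball w (\<delta> / 2)"
  obtains c where "c \<in> D" "c \<in> cball w \<delta>" "norm (z - c) = infdist z D"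
proof -
  obtain c where c: "c \<in> D" "infdist z D = dist z c"
    using infdist_attains_inf[OF closed_D] w_D by blast
  have "dist z c \<le> dist z w" using infdist_le[OF w_D, of z] c by simp
  moreover have "dist w c \<le> dist w z + dist z c" by (rule dist_triangle)
  ultimately have "dist w c \<le> \<delta>" using assms by (simp add: dist_commute)
  with c show ?thesis by (intro that) (auto simp: dist_norm)
qed

text \<open>Since \<open>x (Suc n)\<close> already lies in one of the sets, its distances to the other ones are
  controlled by the next \<open>m - 1\<close> steps.\<close>

lemma infdist_le_sum_steps:
  assumes in_ball: "x n \<in> cball w (\<delta> / 2)" "\<And>i. i < m - 1 \<Longrightarrow> x (Suc n + i) \<in> cball w (\<delta> / 2)"
  shows "infdist (x (Suc n)) D \<le> \<kappa> * (\<Sum>i<m - 1. norm (x (Suc (Suc n + i)) - x (Suc n + i)))"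
proof -
  let ?s = "\<lambda>i. norm (x (Suc (Suc n + i)) - x (Suc n + i))"
  have dist_i: "infdist (x (Suc n)) (C i) \<le> sum ?s {..<m - 1}" if i: "i \<in> {1..m}" for i
  proof (cases "i = idx n")
    case True
    then show ?thesis using x_in[OF in_ball(1)] by (simp add: sum_nonneg)
  next
    case False
    \<comment> \<open>By \<open>idx_period\<close> the window misses only \<open>idx n\<close>, so
      \<open>C i\<close> is visited within it.\<close>
    then have "i \<in> idx ` {Suc n..<Suc n + (m - 1)}"
      using i bij_betw_imp_surj_on[OF bij_idx[of "Suc n"]] unfolding idx_period by blast
    then obtain l where l: "l \<in> {Suc n..<Suc n + (m - 1)}" "i = idx l" by blast
    define j where "j = l - Suc n"
    have j: "j < m - 1" "l = Suc n + j" using l(1) by (auto simp: j_def)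
    have tele: "norm (x (Suc n + b) - x (Suc n)) \<le> sum ?s {..<b}" for b
    proof (induction b)
      case (Suc b)
      then show ?case
        using norm_triangle_ineq[of "x (Suc (Suc n + b)) - x (Suc n + b)" "x (Suc n + b) - x (Suc n)"]
        by simp
    qed simp
    have "x (Suc n + Suc j) \<in> C i" using x_in[OF in_ball(2)[OF j(1)]] l(2) j(2) by simp
    then have "infdist (x (Suc n)) (C i) \<le> dist (x (Suc n)) (x (Suc n + Suc j))"
      by (rule infdist_le)
    also have "\<dots> = norm (x (Suc n + Suc j) - x (Suc n))"
      by (subst dist_commute) (rule dist_norm)
    also have "\<dots> \<le> sum ?s {..<Suc j}" by (rule tele)
    also have "\<dots> \<le> sum ?s {..<m - 1}" using j by (intro sum_mono2) auto
    finally show ?thesis .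
  qed
  have "x (Suc n) \<in> cball w (\<delta> / 2)" using in_ball(2)[of 0] m by simp
  then have "infdist (x (Suc n)) D \<le> \<kappa> * Max ((\<lambda>i. infdist (x (Suc n)) (C i)) ` {1..m})"
    using linreg by (simp add: linearly_regular_def D_def)
  also have "\<dots> \<le> \<kappa> * sum ?s {..<m - 1}"
    using \<kappa> dist_i m by (intro mult_left_mono Max.boundedI) auto
  finally show ?thesis .
qed

text \<open>The same nearest point \<open>c\<close> is kept for the whole block. The growth factors
  contribute at most \<open>\<Gamma>\<^sup>2\<close>, the gains at least the squared initial
  distance over \<open>\<kappa>\<^sup>2 * S\<close>; the difference is bounded by the square of
  \<open>\<rho> ^ (m - 1)\<close>.\<close>

lemma block_contraction:
  assumes in_ball: "x n \<in> cball w (\<delta> / 2)" "\<And>i. i < m - 1 \<Longrightarrow> x (Suc n + i) \<in> cball w (\<delta> / 2)"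
    and c: "c \<in> D" "c \<in> cball w \<delta>" "norm (x (Suc n) - c) = infdist (x (Suc n)) D"
  shows "norm (x (Suc n + (m - 1)) - c) \<le> \<rho> ^ (m - 1) * infdist (x (Suc n)) D"
proof -
  let ?d = "infdist (x (Suc n)) D"
  define s where "s i = norm (x (Suc (Suc n + i)) - x (Suc n + i))" for i
  define b where "b i = (2 - lam (idx (Suc n + i))) / lam (idx (Suc n + i))" for i
  have b: "b i > 0" for i
    using lam[OF idx[of "Suc n + i"]] by (simp add: b_def)
  have inv_le: "(\<Sum>i<m - 1. inverse (b i)) \<le> S"
    using sum_inverse_idx_le[of "Suc n"] by (simp add: b_def)
  have nonneg: "0 \<le> (\<Sum>i<m - 1. b i * (s i)\<^sup>2)"
    using b by (intro sum_nonneg) (simp add: less_imp_le)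
  have "?d\<^sup>2 \<le> (\<kappa> * (\<Sum>i<m - 1. s i))\<^sup>2"
    using infdist_le_sum_steps[OF in_ball] infdist_nonneg unfolding s_def by (intro power_mono) auto
  also have "\<dots> = \<kappa>\<^sup>2 * (\<Sum>i<m - 1. s i)\<^sup>2" by (simp add: power_mult_distrib)
  also have "\<dots> \<le> \<kappa>\<^sup>2 * ((\<Sum>i<m - 1. inverse (b i)) * (\<Sum>i<m - 1. b i * (s i)\<^sup>2))"
    using weighted_Cauchy_Schwarz_sum[of "{..<m - 1}" b s] b by (intro mult_left_mono) auto
  also have "\<dots> \<le> \<kappa>\<^sup>2 * (S * (\<Sum>i<m - 1. b i * (s i)\<^sup>2))"
    using inv_le nonneg by (intro mult_left_mono mult_right_mono) auto
  finally have "?d\<^sup>2 / (\<kappa>\<^sup>2 * S) \<le> (\<Sum>i<m - 1. b i * (s i)\<^sup>2)"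
    using \<kappa> S_pos by (simp add: field_simps)
  moreover have "(norm (x (Suc n + (m - 1)) - c))\<^sup>2
      \<le> (\<Prod>i<m - 1. g (idx (Suc n + i))) * (norm (x (Suc n + 0) - c))\<^sup>2 - (\<Sum>i<m - 1. b i * (s i)\<^sup>2)"
  proof (rule perturbed_contraction_chain[where a = "\<lambda>i. (norm (x (Suc n + i) - c))\<^sup>2"])
    fix i assume "i < m - 1"
    show "(norm (x (Suc n + Suc i) - c))\<^sup>2
        \<le> g (idx (Suc n + i)) * (norm (x (Suc n + i) - c))\<^sup>2 - b i * (s i)\<^sup>2"
      using fejer_step[OF in_ball(2)[OF \<open>i < m - 1\<close>] c(1,2)] by (simp add: b_def s_def)
  qed (use g_ge_1[OF idx] b in \<open>auto simp: less_imp_le\<close>)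
  moreover have "(\<Prod>i<m - 1. g (idx (Suc n + i))) * ?d\<^sup>2 \<le> \<Gamma>\<^sup>2 * ?d\<^sup>2"
    using prod_g_idx_le[of "m - 1" "Suc n"] by (intro mult_right_mono) auto
  ultimately have "(norm (x (Suc n + (m - 1)) - c))\<^sup>2 \<le> (\<Gamma>\<^sup>2 - 1 / (\<kappa>\<^sup>2 * S)) * ?d\<^sup>2"
    using c(3) by (simp add: algebra_simps)
  also have "\<dots> \<le> (\<rho> ^ (m - 1))\<^sup>2 * ?d\<^sup>2"
    unfolding \<rho>_power by (intro mult_right_mono) auto
  finally have "(norm (x (Suc n + (m - 1)) - c))\<^sup>2 \<le> (\<rho> ^ (m - 1) * ?d)\<^sup>2"
    by (simp add: power_mult_distrib)
  then show ?thesis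
    by (rule power2_le_imp_le) (use \<rho>_nonneg in \<open>simp add: infdist_nonneg\<close>)
qed

text \<open>If \<open>\<rho> = 0\<close> and \<open>m \<ge> 3\<close> then \<open>\<kappa> < 1\<close>; as no \<open>C i\<close> is further away than the
  intersection, linear regularity then makes the intersection fill the ball.\<close>

lemma infdist_D_eq_0:
  assumes "\<rho> = 0" "m \<ge> 3" "z \<in> cball w (\<delta> / 2)"
  shows "infdist z D = 0"
proof -
  have "\<Gamma>\<^sup>2 \<le> 1 / (\<kappa>\<^sup>2 * S)"
    using \<rho>_power assms(1,2) by (auto simp: power_0_left max_def split: if_splits)
  moreover have "1 \<le> \<Gamma>\<^sup>2" using \<Gamma>_ge_1 by simp
  ultimately have "1 \<le> 1 / (\<kappa>\<^sup>2 * S)" by linarith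
  then have "\<kappa>\<^sup>2 * S \<le> 1" using \<kappa> S_pos by (simp add: field_simps)
  \<comment> \<open>The hypothesis on \<open>m\<close> enters here: \<open>S\<close> is at least 2,
    which forces \<open>\<kappa>\<close> strictly below 1.\<close>
  moreover have "\<kappa>\<^sup>2 * 2 \<le> \<kappa>\<^sup>2 * S" using S_ge assms(2) by (intro mult_left_mono) auto
  ultimately have "\<kappa>\<^sup>2 < 1\<^sup>2" by simp
  then have "\<kappa> < 1" by (rule power2_less_imp_less) simp
  have "infdist z (C i) \<le> infdist z D" if "i \<in> {1..m}" for i
    using that w_D by (intro infdist_mono) (auto simp: D_def)
  then have "Max ((\<lambda>i. infdist z (C i)) ` {1..m}) \<le> infdist z D"
    using m by (intro Max.boundedI) auto
  then have "\<kappa> * Max ((\<lambda>i. infdist z (C i)) ` {1..m}) \<le> \<kappa> * infdist z D"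
    using \<kappa> by (intro mult_left_mono) auto
  moreover have "infdist z D \<le> \<kappa> * Max ((\<lambda>i. infdist z (C i)) ` {1..m})"
    using linreg assms(3) by (auto simp: linearly_regular_def D_def)
  ultimately have "(1 - \<kappa>) * infdist z D \<le> 0" by (simp add: algebra_simps)
  then show ?thesis
    using \<open>\<kappa> < 1\<close> infdist_nonneg[of z D] by (simp add: mult_le_0_iff)
qed

section \<open>Convergence of sequences that stay in the ball\<close>

text \<open>Block contraction links the distances at \<open>n\<close> and
  \<open>n + (m - 1)\<close>, so each of the \<open>m - 1\<close> interleaved subsequences decays
  from its own first term; \<open>M\<close> dominates all these first terms after rescaling by
  powers of \<open>\<rho>\<close>.\<close>

lemma infdist_D_decay:
  assumes in_ball: "\<And>n. x n \<in> cball w (\<delta> / 2)"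
  obtains M where "M \<ge> 0" "\<And>n. infdist (x (Suc n)) D \<le> M * \<rho> ^ n"
proof -
  let ?d = "\<lambda>n. infdist (x (Suc n)) D"
  have block: "?d (n + (m - 1)) \<le> \<rho> ^ (m - 1) * ?d n" for n
  proof -
    obtain c where c: "c \<in> D" "c \<in> cball w \<delta>" "norm (x (Suc n) - c) = ?d n"
      using nearest_in_D[OF in_ball] .
    have "?d (n + (m - 1)) \<le> norm (x (Suc n + (m - 1)) - c)"
      using infdist_le[OF c(1), of "x (Suc n + (m - 1))"] by (simp add: dist_norm)
    also have "\<dots> \<le> \<rho> ^ (m - 1) * ?d n" by (rule block_contraction[OF in_ball in_ball c])
    finally show ?thesis .
  qed
  define M where "M = (if \<rho> = 0 then ?d 0 else (\<Sum>n<m - 1. ?d n / \<rho> ^ n))"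
  have M: "M \<ge> 0"
    using infdist_nonneg \<rho>_nonneg by (auto simp: M_def intro!: sum_nonneg)
  have "?d n \<le> M * \<rho> ^ n" for n
  proof (cases "\<rho> = 0")
    case True
    show ?thesis
    proof (cases n)
      case 0
      then show ?thesis by (simp add: M_def True)
    next
      case (Suc l)
      \<comment> \<open>For \<open>m = 2\<close> a block is a single step, so contraction by 0
        suffices. For larger \<open>m\<close> it says nothing about the indices below
        \<open>m - 1\<close>, and \<open>infdist_D_eq_0\<close> takes over.\<close>
      have "?d n = 0"
      proof (cases "m = 2")
        case True
        then have "?d n \<le> 0" using block[of l] Suc \<open>\<rho> = 0\<close> by simp
        then show ?thesis using infdist_nonneg[of "x (Suc n)" D] by linarith
      next
        case False
        then show ?thesis using infdist_D_eq_0[OF True _ in_ball] m by simp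
      qed
      then show ?thesis using M \<rho>_nonneg by simp
    qed
  next
    case False
    then have \<rho>: "\<rho> > 0" using \<rho>_nonneg by simp
    show ?thesis
    proof (induction n rule: less_induct)
      case (less n)
      show ?case
      proof (cases "n < m - 1")
        case True
        then have "?d n / \<rho> ^ n \<le> (\<Sum>n<m - 1. ?d n / \<rho> ^ n)"
          using \<rho> by (intro member_le_sum[of n "{..<m - 1}" "\<lambda>n. ?d n / \<rho> ^ n"])
            (auto simp: infdist_nonneg)
        also have "\<dots> = M" using \<rho> by (simp add: M_def)
        finally show ?thesis using \<rho> by (simp add: field_simps)
      next
        case False
        define l where "l = n - (m - 1)"
        have l: "n = l + (m - 1)" "l < n" using False m by (auto simp: l_def)
        have "?d n \<le> \<rho> ^ (m - 1) * ?d l" using block[of l] l(1) by simp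
        also have "\<dots> \<le> \<rho> ^ (m - 1) * (M * \<rho> ^ l)"
          using less[OF l(2)] \<rho> by (intro mult_left_mono) auto
        also have "\<dots> = M * \<rho> ^ n" by (simp add: l(1) power_add)
        finally show ?thesis .
      qed
    qed
  qed
  with M show ?thesis by (rule that)
qed

text \<open>Comparing both ends of a step with a nearest point of \<open>D\<close> bounds its length
  by \<open>\<Gamma> + 1\<close> times the distance to \<open>D\<close>, so the steps inherit the
  geometric decay. The limit is in \<open>D\<close> because the distances tend to 0.\<close>

lemma convergence_in_ball:
  assumes in_ball: "\<And>n. x n \<in> cball w (\<delta> / 2)"
  shows "\<exists>xbar\<in>(\<Inter>i\<in>{1..m}. C i).
           if \<rho> > 0 then R_linearly_converges x xbar \<rho>
           else R_linearly_converges (\<lambda>n. x (n + 1)) xbar \<rho>"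
proof -
  obtain M where M: "M \<ge> 0" "\<And>n. infdist (x (Suc n)) D \<le> M * \<rho> ^ n"
    using infdist_D_decay[OF in_ball] by blast
  have step: "norm (x (Suc n + 1) - x (n + 1)) \<le> ((\<Gamma> + 1) * M) * \<rho> ^ n" for n
  proof -
    obtain c where c: "c \<in> D" "c \<in> cball w \<delta>" "norm (x (Suc n) - c) = infdist (x (Suc n)) D"
      using nearest_in_D[OF in_ball] .
    have "norm (x (Suc n + 1) - x (n + 1)) \<le> norm (x (Suc n + 1) - c) + norm (x (Suc n) - c)"
      using norm_triangle_ineq4[of "x (Suc n + 1) - c" "x (Suc n) - c"] by simp
    also have "\<dots> \<le> \<Gamma> * norm (x (Suc n) - c) + norm (x (Suc n) - c)"
      using stay[OF in_ball c(1,2), of 1 "Suc n"] m by simp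
    also have "\<dots> = (\<Gamma> + 1) * infdist (x (Suc n)) D" by (simp add: c(3) algebra_simps)
    also have "\<dots> \<le> (\<Gamma> + 1) * (M * \<rho> ^ n)"
      using M(2) \<Gamma>_ge_1 by (intro mult_left_mono) auto
    finally show ?thesis by (simp add: mult.assoc)
  qed
  have "0 \<le> (\<Gamma> + 1) * M" using M(1) \<Gamma>_ge_1 by simp
  from geometric_steps_imp_R_linear[of \<rho> _ "\<lambda>n. x (n + 1)", OF \<rho>_nonneg \<rho>_less this step]
  obtain xbar where xbar: "(\<lambda>n. x (n + 1)) \<longlonglongrightarrow> xbar" "R_linearly_converges (\<lambda>n. x (n + 1)) xbar \<rho>"
    by blast
  have "(\<lambda>n. infdist (x (n + 1)) D) \<longlonglongrightarrow> infdist xbar D"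
    using xbar(1) by (intro tendsto_infdist)
  moreover have "(\<lambda>n. M * \<rho> ^ n) \<longlonglongrightarrow> 0"
    using \<rho>_nonneg \<rho>_less by (intro tendsto_mult_right_zero LIMSEQ_power_zero) auto
  ultimately have "infdist xbar D \<le> 0"
    using M(2) by (intro LIMSEQ_le) auto
  then have "infdist xbar D = 0" using infdist_nonneg[of xbar D] by linarith
  then have "xbar \<in> D" using closed_D w_D in_closed_iff_infdist_zero by blast
  then show ?thesis
    using xbar(2) R_linearly_converges_shift[of x] unfolding D_def
    by (intro bexI[of _ xbar]) auto
qed

section \<open>Confinement of the sequence to the ball\<close>

text \<open>Strong induction: the earlier iterates that \<open>stay\<close> requires in the ball are
  supplied by the induction hypothesis.\<close>

lemma stay_in_ball:
  assumes "\<Gamma> * norm (x N - w) \<le> \<delta> / 2" "j \<le> m - 1"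
  shows "x (N + j) \<in> cball w (\<delta> / 2)"
  using assms(2)
proof (induction j rule: less_induct)
  case (less j)
  have "norm (x (N + j) - w) \<le> \<Gamma> * norm (x N - w)"
    using less w_D \<delta> by (intro stay) auto
  then show ?case using assms(1) by (simp add: dist_norm norm_minus_commute)
qed

text \<open>The step before the first block costs an extra \<open>sqrt G\<close>; the inverse square
  root in the definition of \<open>\<delta>bar\<close> compensates for it.\<close>

lemma first_step:
  assumes "x 0 \<in> cball w (\<delta> / 2)" "\<And>i. i \<in> {1..m} \<Longrightarrow> g i \<le> G"
  shows "norm (x 1 - w) \<le> sqrt G * norm (x 0 - w)"
proof -
  have "0 \<le> (2 - lam (idx 0)) / lam (idx 0) * (norm (x (Suc 0) - x 0))\<^sup>2"
    using lam[OF idx[of 0]] by simp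
  then have "(norm (x 1 - w))\<^sup>2 \<le> g (idx 0) * (norm (x 0 - w))\<^sup>2"
    using fejer_step[OF assms(1) w_D] \<delta> by simp
  also have "\<dots> \<le> G * (norm (x 0 - w))\<^sup>2"
    using assms(2)[OF idx] by (intro mult_right_mono) auto
  also have "\<dots> = (sqrt G * norm (x 0 - w))\<^sup>2"
    using assms(2)[OF idx[of 0]] g_ge_1[OF idx[of 0]] by (simp add: power_mult_distrib)
  finally show ?thesis
    by (rule power2_le_imp_le)
       (use assms(2)[OF idx[of 0]] g_ge_1[OF idx[of 0]] in simp)
qed

text \<open>The blocks start at \<open>x 1\<close>, since \<open>x 0\<close> need not belong to any of the sets.\<close>

lemma in_ball_of_start:
  assumes E: "norm (x 1 - w) \<le> E" "\<Gamma> * (2 * E / (1 - \<rho>)) \<le> \<delta> / 2" and x0: "x 0 \<in> cball w (\<delta> / 2)"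
  shows "x n \<in> cball w (\<delta> / 2)"
proof -
  define q where "q = \<rho> ^ (m - 1)"
  have "q \<le> \<rho> ^ 1"
    unfolding q_def using \<rho>_nonneg \<rho>_less m by (intro power_decreasing) auto
  then have q: "0 \<le> q" "q \<le> \<rho>" "q < 1"
    using \<rho>_nonneg \<rho>_less by (auto simp: q_def)
  have E0: "E \<ge> 0" using E(1) norm_ge_zero order_trans by blast
  let ?N = "\<lambda>l. 1 + l * (m - 1)"
  \<comment> \<open>Block \<open>i\<close> moves its starting point by at most
    \<open>(1 + q) * q ^ i * E\<close>: both endpoints are compared with a nearest point of
    \<open>D\<close>. Summing over all blocks and adding \<open>E\<close> gives at most
    \<open>2 * E / (1 - q)\<close>.\<close>
  define B where "B l = E * (1 + (1 + q) * (\<Sum>i<l. q ^ i))" for l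
  have B: "\<Gamma> * B l \<le> \<delta> / 2" for l
  proof -
    have "(1 - q) * (\<Sum>i<l. q ^ i) = 1 - q ^ l" by (simp add: one_diff_power_eq)
    then have "(\<Sum>i<l. q ^ i) = (1 - q ^ l) / (1 - q)" using q by (simp add: field_simps)
    also have "\<dots> \<le> 1 / (1 - q)" using q by (intro divide_right_mono) auto
    finally have "1 + (1 + q) * (\<Sum>i<l. q ^ i) \<le> 1 + (1 + q) * (1 / (1 - q))"
      using q by (intro add_left_mono mult_left_mono) auto
    also have "\<dots> = 2 / (1 - q)" using q by (simp add: field_simps)
    also have "\<dots> \<le> 2 / (1 - \<rho>)" using q \<rho>_less by (intro divide_left_mono) auto
    finally have "B l \<le> E * (2 / (1 - \<rho>))" unfolding B_def using E0 by (intro mult_left_mono)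
    then have "\<Gamma> * B l \<le> \<Gamma> * (E * (2 / (1 - \<rho>)))" using \<Gamma>_ge_1 by (intro mult_left_mono) auto
    moreover have "\<Gamma> * (E * (2 / (1 - \<rho>))) = \<Gamma> * (2 * E / (1 - \<rho>))" by simp
    ultimately show ?thesis using E(2) by linarith
  qed
  \<comment> \<open>The third conjunct carries the iterate just before the block, which
    \<open>block_contraction\<close> also requires in the ball.\<close>
  have main: "norm (x (?N l) - w) \<le> B l \<and> infdist (x (?N l)) D \<le> q ^ l * E
      \<and> x (l * (m - 1)) \<in> cball w (\<delta> / 2)" for l
  proof (induction l)
    case 0
    have "infdist (x 1) D \<le> norm (x 1 - w)"
      using infdist_le[OF w_D, of "x 1"] by (simp add: dist_norm)
    then show ?case using E(1) x0 by (simp add: B_def)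
  next
    case (Suc l)
    have "\<Gamma> * norm (x (?N l) - w) \<le> \<Gamma> * B l"
      using Suc \<Gamma>_ge_1 by (intro mult_left_mono) auto
    then have \<Gamma>N: "\<Gamma> * norm (x (?N l) - w) \<le> \<delta> / 2" using B[of l] by linarith
    have ball: "x (Suc (l * (m - 1)) + j) \<in> cball w (\<delta> / 2)" if "j \<le> m - 1" for j
      using stay_in_ball[OF \<Gamma>N that] by simp
    have ball0: "x (Suc (l * (m - 1))) \<in> cball w (\<delta> / 2)" using ball[of 0] by simp
    obtain c where c: "c \<in> D" "c \<in> cball w \<delta>"
        "norm (x (Suc (l * (m - 1))) - c) = infdist (x (Suc (l * (m - 1)))) D"
      using nearest_in_D[OF ball0] .
    let ?d = "infdist (x (?N l)) D"
    have next_eq: "Suc (l * (m - 1)) + (m - 1) = ?N (Suc l)" by simp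
    have near: "norm (x (?N (Suc l)) - c) \<le> q * ?d"
      using block_contraction[OF _ _ c, unfolded next_eq] Suc ball by (simp add: q_def)
    also have "\<dots> \<le> q * (q ^ l * E)" using Suc q by (intro mult_left_mono) auto
    finally have near': "norm (x (?N (Suc l)) - c) \<le> q * (q ^ l * E)" .
    have "norm (x (?N (Suc l)) - w)
        \<le> norm (x (?N (Suc l)) - c) + norm (x (?N l) - c) + norm (x (?N l) - w)"
      using norm_triangle_ineq4[of "x (?N (Suc l)) - c" "x (?N l) - c"]
        norm_triangle_ineq[of "x (?N (Suc l)) - x (?N l)" "x (?N l) - w"] by simp
    also have "\<dots> \<le> q * (q ^ l * E) + q ^ l * E + B l"
      using near' c(3) Suc by simp
    also have "\<dots> = B (Suc l)" by (simp add: B_def algebra_simps)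
    finally have 1: "norm (x (?N (Suc l)) - w) \<le> B (Suc l)" .
    have "infdist (x (?N (Suc l))) D \<le> norm (x (?N (Suc l)) - c)"
      using infdist_le[OF c(1), of "x (?N (Suc l))"] by (simp add: dist_norm)
    then have 2: "infdist (x (?N (Suc l))) D \<le> q ^ Suc l * E" using near' by (simp add: mult.assoc)
    have last_eq: "Suc (l * (m - 1)) + (m - 1 - 1) = Suc l * (m - 1)" using m by simp
    have 3: "x (Suc l * (m - 1)) \<in> cball w (\<delta> / 2)"
      by (rule ball[of "m - 1 - 1", unfolded last_eq]) simp
    from 1 2 3 show ?case by blast
  qed
  show ?thesis
  proof (cases n)
    case 0
    then show ?thesis using x0 by simp
  next
    case (Suc n')
    define l where "l = n' div (m - 1)"
    have "\<Gamma> * norm (x (?N l) - w) \<le> \<Gamma> * B l"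
      using main \<Gamma>_ge_1 by (intro mult_left_mono) auto
    then have "\<Gamma> * norm (x (?N l) - w) \<le> \<delta> / 2" using B[of l] by linarith
    then have "x (?N l + n' mod (m - 1)) \<in> cball w (\<delta> / 2)"
      by (rule stay_in_ball) (use m in \<open>simp add: less_imp_le\<close>)
    moreover have "?N l + n' mod (m - 1) = n" by (simp add: l_def Suc div_mult_mod_eq)
    ultimately show ?thesis by simp
  qed
qed

text \<open>Either alternative only serves to keep the whole sequence in the ball. In the first,
  every block starts close enough to \<open>w\<close>; in the second,
  \<open>in_ball_of_start\<close> applies with \<open>E\<close> equal to \<open>sqrt G\<close> times
  the starting radius.\<close>

lemma convergence_of_start:
  fixes \<delta>bar :: real
  defines "\<delta>bar \<equiv> \<delta> / (2 * \<Gamma>) * inverse (sqrt (1 + Max ((\<lambda>i. lam i * \<epsilon> / (1 - \<epsilon>)) ` {1..m})))"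
  assumes start: "(\<forall>n. x ((m - 1) * n) \<in> cball w \<delta>bar) \<or> x 0 \<in> cball w (\<delta>bar * (1 - \<rho>) / (2 + \<Gamma> - \<rho>))"
  shows "\<exists>xbar\<in>(\<Inter>i\<in>{1..m}. C i).
           if \<rho> > 0 then R_linearly_converges x xbar \<rho>
           else R_linearly_converges (\<lambda>n. x (n + 1)) xbar \<rho>"
proof (rule convergence_in_ball)
  fix n
  define G where "G = 1 + Max ((\<lambda>i. lam i * \<epsilon> / (1 - \<epsilon>)) ` {1..m})"
  have g_le: "g i \<le> G" if "i \<in> {1..m}" for i
    unfolding g_def G_def using that by (intro add_left_mono Max_ge) auto
  have G: "G \<ge> 1" using g_le[OF idx[of 0]] g_ge_1[OF idx[of 0]] by linarith
  have \<delta>bar: "\<Gamma> * sqrt G * \<delta>bar = \<delta> / 2" "\<delta>bar > 0"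
    unfolding \<delta>bar_def G_def[symmetric] using \<Gamma>_ge_1 G \<delta> by (auto simp: field_simps)
  have \<Gamma>\<delta>bar: "\<Gamma> * \<delta>bar \<le> \<delta> / 2"
  proof -
    have "(\<Gamma> * \<delta>bar) * 1 \<le> (\<Gamma> * \<delta>bar) * sqrt G"
      using \<Gamma>_ge_1 G \<delta>bar(2) by (intro mult_left_mono) auto
    then show ?thesis using \<delta>bar(1) by (simp add: mult_ac)
  qed
  show "x n \<in> cball w (\<delta> / 2)"
    using start
  proof
    assume H: "\<forall>n. x ((m - 1) * n) \<in> cball w \<delta>bar"
    let ?N = "(m - 1) * (n div (m - 1))"
    have "norm (x ?N - w) \<le> \<delta>bar" using H by (simp add: dist_norm norm_minus_commute)
    then have "\<Gamma> * norm (x ?N - w) \<le> \<Gamma> * \<delta>bar" using \<Gamma>_ge_1 by (intro mult_left_mono) auto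
    then have "\<Gamma> * norm (x ?N - w) \<le> \<delta> / 2" using \<Gamma>\<delta>bar by linarith
    then have "x (?N + n mod (m - 1)) \<in> cball w (\<delta> / 2)"
      by (rule stay_in_ball) (use m in \<open>simp add: less_imp_le\<close>)
    then show ?thesis by simp
  next
    define \<eta> where "\<eta> = \<delta>bar * (1 - \<rho>) / (2 + \<Gamma> - \<rho>)"
    assume "x 0 \<in> cball w (\<delta>bar * (1 - \<rho>) / (2 + \<Gamma> - \<rho>))"
    then have x0: "norm (x 0 - w) \<le> \<eta>" by (simp add: \<eta>_def dist_norm norm_minus_commute)
    \<comment> \<open>The denominator \<open>2 + \<Gamma> - \<rho>\<close> is at least 2, since
      \<open>\<rho> < 1\<close> and \<open>\<Gamma>\<close> is at least 1.\<close>
    have \<eta>: "2 * \<eta> / (1 - \<rho>) \<le> \<delta>bar"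
    proof -
      have "2 * \<eta> / (1 - \<rho>) = \<delta>bar * (2 / (2 + \<Gamma> - \<rho>))"
        using \<rho>_less by (simp add: \<eta>_def)
      also have "\<dots> \<le> \<delta>bar * 1"
        using \<rho>_less \<Gamma>_ge_1 \<delta>bar(2) by (intro mult_left_mono) auto
      finally show ?thesis by simp
    qed
    have "\<eta> \<ge> 0" using x0 norm_ge_zero order_trans by blast
    then have "\<eta> \<le> 2 * \<eta> / (1 - \<rho>)"
      using \<rho>_less \<rho>_nonneg by (simp add: field_simps mult_left_le_one_le add_increasing)
    then have "norm (x 0 - w) \<le> \<delta>bar" using \<eta> x0 by linarith
    moreover have "1 * \<delta>bar \<le> \<Gamma> * \<delta>bar" using \<Gamma>_ge_1 \<delta>bar(2) by (intro mult_right_mono) auto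
    ultimately have x0_ball: "x 0 \<in> cball w (\<delta> / 2)"
      using \<Gamma>\<delta>bar by (simp add: dist_norm norm_minus_commute)
    have "norm (x 1 - w) \<le> sqrt G * norm (x 0 - w)"
      by (rule first_step[OF x0_ball g_le])
    also have "\<dots> \<le> sqrt G * \<eta>" using x0 G by (intro mult_left_mono) auto
    finally have x1: "norm (x 1 - w) \<le> sqrt G * \<eta>" .
    have "\<Gamma> * (2 * (sqrt G * \<eta>) / (1 - \<rho>)) = \<Gamma> * sqrt G * (2 * \<eta> / (1 - \<rho>))" by simp
    also have "\<dots> \<le> \<Gamma> * sqrt G * \<delta>bar" using \<eta> \<Gamma>_ge_1 G by (intro mult_left_mono) auto
    finally have "\<Gamma> * (2 * (sqrt G * \<eta>) / (1 - \<rho>)) \<le> \<delta> / 2" using \<delta>bar(1) by simp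
    then show ?thesis by (rule in_ball_of_start[OF x1 _ x0_ball])
  qed
qed

end

section \<open>Choice of the radius and conclusion\<close>

theorem theorem5p8:
  fixes C :: "nat \<Rightarrow> 'a::euclidean_space set"
    and w :: 'a
    and m :: nat
    and \<epsilon> \<delta> \<kappa> \<Gamma> \<rho> :: real
    and \<tau> lam :: "nat \<Rightarrow> real"
  assumes "m \<ge> 2"
    and "\<forall>i\<in>{1..m}. closed (C i)"
    and "w \<in> (\<Inter>i\<in>{1..m}. C i)"
    and "0 \<le> \<epsilon>" and "\<epsilon> < 1" and "\<delta> > 0"
    and "\<forall>i\<in>{1..m}. \<tau> i \<ge> 0"
    and a: "\<kappa> > 0" "linearly_regular {1..m} C \<kappa> (cball w (\<delta> / 2))"
    and b: "\<forall>i\<in>{1..m}. eps_delta_regular \<epsilon> \<delta> (C i) w"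
    and c: "\<forall>i\<in>{1..m}. 1 \<le> lam i \<and> lam i < 2 \<and>
              injectable (\<tau> i) (C i) (cball w (\<delta> / 2)) \<and> (lam i > 1 \<longrightarrow> \<tau> i > 0)"
    and d: "\<Gamma> = Max ((\<lambda>j. \<Prod>i\<in>{1..m} - {j}. sqrt (1 + lam i * \<epsilon> / (1 - \<epsilon>))) ` {1..m})"
           "\<rho> = (max 0 (\<Gamma>\<^sup>2 - 1 / \<kappa>\<^sup>2 *
                    inverse ((\<Sum>i\<in>{1..m}. lam i / (2 - lam i))
                             - Min ((\<lambda>i. lam i / (2 - lam i)) ` {1..m}))))
                  powr (1 / (2 * (real m - 1)))"
           "\<rho> < 1"
  shows "(\<exists>r>0. \<forall>x. cyclic_sequence m (\<lambda>i. relaxed_proj (lam i) (C i)) x \<and> x 0 \<in> cball w r \<longrightarrow>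
            (\<exists>xbar \<in> (\<Inter>i\<in>{1..m}. C i).
               if \<rho> > 0 then R_linearly_converges x xbar \<rho>
               else R_linearly_converges (\<lambda>n. x (n + 1)) xbar \<rho>))
       \<and> (\<forall>\<delta>' \<delta>bar. 0 < \<delta>' \<and> \<delta>' \<le> \<delta> \<and> (\<forall>i\<in>{1..m}. lam i > 1 \<longrightarrow> \<delta>' / 2 \<le> \<tau> i) \<and>
            \<delta>bar = \<delta>' / (2 * \<Gamma>) *
                   inverse (sqrt (1 + Max ((\<lambda>i. lam i * \<epsilon> / (1 - \<epsilon>)) ` {1..m}))) \<longrightarrow>
            (\<forall>x. cyclic_sequence m (\<lambda>i. relaxed_proj (lam i) (C i)) x \<and>
                 ((\<forall>n. x ((m - 1) * n) \<in> cball w \<delta>bar) \<or>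
                  x 0 \<in> cball w (\<delta>bar * (1 - \<rho>) / (2 + \<Gamma> - \<rho>))) \<longrightarrow>
               (\<exists>xbar \<in> (\<Inter>i\<in>{1..m}. C i).
                  if \<rho> > 0 then R_linearly_converges x xbar \<rho>
                  else R_linearly_converges (\<lambda>n. x (n + 1)) xbar \<rho>)))"
proof -
  let ?conv = "\<lambda>x. \<exists>xbar \<in> (\<Inter>i\<in>{1..m}. C i).
                  if \<rho> > 0 then R_linearly_converges x xbar \<rho>
                  else R_linearly_converges (\<lambda>n. x (n + 1)) xbar \<rho>"
  let ?G = "1 + Max ((\<lambda>i. lam i * \<epsilon> / (1 - \<epsilon>)) ` {1..m})"
  let ?bar = "\<lambda>\<delta>'. \<delta>' / (2 * \<Gamma>) * inverse (sqrt ?G)"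
  have loc: "cyclic_relaxed_projections C w m \<epsilon> \<delta>' \<kappa> \<Gamma> \<rho> lam x"
    if \<delta>': "0 < \<delta>'" "\<delta>' \<le> \<delta>" "\<forall>i\<in>{1..m}. lam i > 1 \<longrightarrow> \<delta>' / 2 \<le> \<tau> i"
      and x: "cyclic_sequence m (\<lambda>i. relaxed_proj (lam i) (C i)) x" for \<delta>' x
  proof unfold_locales
    show "linearly_regular {1..m} C \<kappa> (cball w (\<delta>' / 2))"
      using a(2) \<delta>'(2) by (auto simp: linearly_regular_def)
    show "eps_delta_regular \<epsilon> \<delta>' (C i) w" if "i \<in> {1..m}" for i
      using b that \<delta>'(2) by (auto simp: eps_delta_regular_def)
    show "relaxed_proj (lam i) (C i) z \<subseteq> C i"
      if "i \<in> {1..m}" "z \<in> cball w (\<delta>' / 2)" for i z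
    proof (rule relaxed_proj_subset)
      show "injectable (\<tau> i) (C i) (cball w (\<delta> / 2))" "1 \<le> lam i" "lam i < 2" "w \<in> C i"
        using c that(1) assms(3) by auto
      show "z \<in> cball w (\<delta> / 2)" using that(2) \<delta>'(2) by simp
      show "dist w z \<le> \<tau> i" if "1 < lam i"
      proof -
        have "\<delta>' / 2 \<le> \<tau> i" using \<delta>'(3) \<open>i \<in> {1..m}\<close> that by blast
        then show ?thesis using \<open>z \<in> cball w (\<delta>' / 2)\<close> by simp
      qed
    qed
    show "1 \<le> lam i \<and> lam i < 2" "closed (C i)" if "i \<in> {1..m}" for i
      using c assms(2) that by auto
  qed (fact assms a d \<delta>' x)+
  have second: "?conv x"
    if "0 < \<delta>'" "\<delta>' \<le> \<delta>" "\<forall>i\<in>{1..m}. lam i > 1 \<longrightarrow> \<delta>' / 2 \<le> \<tau> i"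
      "cyclic_sequence m (\<lambda>i. relaxed_proj (lam i) (C i)) x"
      "(\<forall>n. x ((m - 1) * n) \<in> cball w (?bar \<delta>')) \<or> x 0 \<in> cball w (?bar \<delta>' * (1 - \<rho>) / (2 + \<Gamma> - \<rho>))"
    for \<delta>' x
    using cyclic_relaxed_projections.convergence_of_start[OF loc[OF that(1-4)] that(5)] .
  \<comment> \<open>The largest admissible \<open>\<delta>'\<close>. Inserting
    \<open>\<delta>\<close> keeps the minimum well defined when all relaxation parameters are
    1.\<close>
  define \<delta>0 where "\<delta>0 = Min (insert \<delta> ((\<lambda>i. 2 * \<tau> i) ` {i\<in>{1..m}. lam i > 1}))"
  have \<delta>0: "0 < \<delta>0" "\<delta>0 \<le> \<delta>" "\<forall>i\<in>{1..m}. lam i > 1 \<longrightarrow> \<delta>0 / 2 \<le> \<tau> i"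
  proof -
    show "0 < \<delta>0" unfolding \<delta>0_def using \<open>\<delta> > 0\<close> c by (subst Min_gr_iff) auto
    show "\<delta>0 \<le> \<delta>" unfolding \<delta>0_def by (intro Min_le) auto
    have "\<delta>0 \<le> 2 * \<tau> i" if "i \<in> {1..m}" "lam i > 1" for i
      unfolding \<delta>0_def using that by (intro Min_le) auto
    then show "\<forall>i\<in>{1..m}. lam i > 1 \<longrightarrow> \<delta>0 / 2 \<le> \<tau> i" by force
  qed
  \<comment> \<open>The radius must be positive before any sequence is given, so positivity of
    \<open>\<Gamma>\<close> is derived outside the locale, which fixes a sequence.\<close>
  have ge0: "0 \<le> lam i * \<epsilon> / (1 - \<epsilon>)" if "i \<in> {1..m}" for i
  proof -
    have "1 \<le> lam i" using c that by blast
    then show ?thesis using \<open>0 \<le> \<epsilon>\<close> \<open>\<epsilon> < 1\<close> by simp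
  qed
  have one: "1 \<in> {1..m}" using \<open>m \<ge> 2\<close> by simp
  have "0 \<le> lam 1 * \<epsilon> / (1 - \<epsilon>)" by (rule ge0[OF one])
  also have "\<dots> \<le> Max ((\<lambda>i. lam i * \<epsilon> / (1 - \<epsilon>)) ` {1..m})"
    using one by (intro Max_ge) auto
  finally have G: "?G > 0" by simp
  have "0 < (\<Prod>i\<in>{1..m} - {1}. sqrt (1 + lam i * \<epsilon> / (1 - \<epsilon>)))"
    using ge0 by (intro prod_pos) (force simp: add_pos_nonneg)
  also have "\<dots> \<le> \<Gamma>" unfolding d(1) using one by (intro Max_ge) auto
  finally have "\<Gamma> > 0" .
  then have r: "?bar \<delta>0 * (1 - \<rho>) / (2 + \<Gamma> - \<rho>) > 0"
    using G \<open>0 < \<delta>0\<close> d(3) by (intro divide_pos_pos mult_pos_pos) auto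
  show ?thesis
  proof (intro conjI)
    \<comment> \<open>The local statement is the second alternative of \<open>second\<close>, taken
      at \<open>\<delta>0\<close>.\<close>
    show "\<exists>r>0. \<forall>x. cyclic_sequence m (\<lambda>i. relaxed_proj (lam i) (C i)) x \<and> x 0 \<in> cball w r \<longrightarrow> ?conv x"
      using r second[OF \<delta>0] by blast
  qed (use second in blast)
qed

end
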